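(* For every integer $m$ and every positive integer $n$, \[ \sum_{j=1}^n\binom{n}{j}\Big\lfloor\frac{j}{2}\Big\rfloor F_{j+m}=\frac n2F_{2n+m-1}-\frac14\big(F_{2n+m}+(-1)^mF_{n-m}\big) \] and \[ \sum_{j=1}^n\binom{n}{j}\Big\lfloor\frac{j}{2}\Big\rfloor L_{j+m}=\frac n2L_{2n+m-1}-\frac14\big(L_{2n+m}-(-1)^mL_{n-m}\big). \]
   Context: $F_n$ and $L_n$ are the Fibonacci and Lucas numbers ($F_0=0,F_1=1$, $L_0=2,L_1=1$, $X_n=X_{n-1}+X_{n-2}$), extended to negative indices by $F_{-n}=(-1)^{n-1}F_n$, $L_{-n}=(-1)^nL_n$. $\lfloor x\rfloor$ is the floor function. *)

theory Defs
  imports Complex_Main "HOL-Number_Theory.Fib"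
begin

fun lucas :: "nat \<Rightarrow> nat" where
  "lucas 0 = 2"
| "lucas (Suc 0) = 1"
| "lucas (Suc (Suc n)) = lucas (Suc n) + lucas n"

text \<open>
  Extensions to all integer indices by \<open>F\<^sub>-\<^sub>n = (-1)\<^sup>n\<^sup>-\<^sup>1 F\<^sub>n\<close> and \<open>L\<^sub>-\<^sub>n = (-1)\<^sup>n L\<^sub>n\<close>.
  In the negative case \<open>nat (- k) \<ge> 1\<close>, so the subtraction in the exponent does not truncate.
\<close>

definition fib_int :: "int \<Rightarrow> int" where
  "fib_int k = (if 0 \<le> k then int (fib (nat k))
                else (- 1) ^ (nat (- k) - 1) * int (fib (nat (- k))))"

definition lucas_int :: "int \<Rightarrow> int" where
  "lucas_int k = (if 0 \<le> k then int (lucas (nat k))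
                  else (- 1) ^ nat (- k) * int (lucas (nat (- k))))"

end

(*
  Write \<lfloor>j/2\<rfloor> = j/2 - 1/4 + (-1)^j/4.  For any two-sided solution G of the
  Fibonacci recurrence, Pascal's rule gives by induction on n the binomial sums of G (j + m)
  weighted by 1, by (-1)^j and by j; the middle one produces G (m - n), which the reflection
  formulas for F and L turn into the stated form.
*)
theory Submission
  imports Defs
begin

text \<open>Pascal's rule under the sum. Keeping \<open>f\<close> arbitrary lets one lemma drive all
  three inductions: the weights 1, \<open>(- 1) ^ j\<close> and \<open>j\<close> are absorbed into
  \<open>f\<close>.\<close>

lemma sum_choose_Suc:
  fixes f :: "nat \<Rightarrow> 'a::comm_semiring_1"
  shows "(\<Sum>j\<le>Suc n. of_nat (Suc n choose j) * f j)
       = (\<Sum>j\<le>n. of_nat (n choose j) * (f j + f (Suc j)))"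
proof -
  have "(\<Sum>j\<le>Suc n. of_nat (Suc n choose j) * f j)
      = f 0 + (\<Sum>j\<le>n. of_nat (n choose Suc j) * f (Suc j))
            + (\<Sum>j\<le>n. of_nat (n choose j) * f (Suc j))"
    by (subst sum.atMost_Suc_shift) (simp add: sum.distrib algebra_simps)
  also have "f 0 + (\<Sum>j\<le>n. of_nat (n choose Suc j) * f (Suc j))
           = (\<Sum>j\<le>Suc n. of_nat (n choose j) * f j)"
    by (subst sum.atMost_Suc_shift) simp
  also have "\<dots> = (\<Sum>j\<le>n. of_nat (n choose j) * f j)"
    by (simp add: binomial_eq_0)
  finally show ?thesis
    by (simp add: sum.distrib algebra_simps)
qed

lemma real_floor_half: "real_of_int \<lfloor>real j / 2\<rfloor> = real j / 2 - 1 / 4 + (- 1) ^ j / 4"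
proof (cases "even j")
  case True
  then obtain k where "j = 2 * k" by blast
  then show ?thesis by simp
next
  case False
  then obtain k where "j = 2 * k + 1" by (blast elim: oddE)
  moreover have "\<lfloor>real (2 * k + 1) / 2\<rfloor> = int k"
    by (rule floor_unique) auto
  ultimately show ?thesis by (simp add: field_simps)
qed

context
  fixes G :: "int \<Rightarrow> real"
  assumes rec: "\<And>k. G (k + 2) = G (k + 1) + G k"
begin

text \<open>With E the shift of the index by one, the recurrence says 1 + E = E^2 on
  \<open>G\<close>, so (1 + E)^n = E^(2n). The induction needs \<open>m\<close> arbitrary because
  Pascal's rule also yields the sum at \<open>m + 1\<close>.\<close>

lemma sum_choose_recurrence:
  "(\<Sum>j\<le>n. real (n choose j) * G (int j + m)) = G (2 * int n + m)"
proof (induction n arbitrary: m)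
  case (Suc n)
  have "(\<Sum>j\<le>Suc n. real (Suc n choose j) * G (int j + m))
      = (\<Sum>j\<le>n. real (n choose j) * G (int j + m))
        + (\<Sum>j\<le>n. real (n choose j) * G (int j + (m + 1)))"
    by (subst sum_choose_Suc) (simp add: distrib_left sum.distrib algebra_simps)
  also have "\<dots> = G (2 * int (Suc n) + m)"
    using rec[of "2 * int n + m"] unfolding Suc.IH by (simp add: algebra_simps)
  finally show ?case .
qed simp

text \<open>Here the operator is 1 - E, which acts on \<open>G\<close> as minus the inverse of E.
  Each step thus lowers the index by one and flips the sign, which is why \<open>G\<close> must live
  on all integers.\<close>

lemma sum_choose_alternating_recurrence:
  "(\<Sum>j\<le>n. real (n choose j) * ((- 1) ^ j * G (int j + m))) = (- 1) ^ n * G (m - int n)"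
proof (induction n arbitrary: m)
  case (Suc n)
  have "(\<Sum>j\<le>Suc n. real (Suc n choose j) * ((- 1) ^ j * G (int j + m)))
      = (\<Sum>j\<le>n. real (n choose j) * ((- 1) ^ j * G (int j + m)))
        - (\<Sum>j\<le>n. real (n choose j) * ((- 1) ^ j * G (int j + (m + 1))))"
    by (subst sum_choose_Suc) (simp add: right_diff_distrib sum_subtractf algebra_simps)
  also have "\<dots> = (- 1) ^ n * (G (m - int n) - G (m + 1 - int n))"
    by (simp only: Suc.IH right_diff_distrib)
  also have "\<dots> = (- 1) ^ Suc n * G (m - int (Suc n))"
    using rec[of "m - int n - 1"] by (simp add: algebra_simps)
  finally show ?case .
qed simp

text \<open>In operator terms this is n E (1 + E)^(n-1) = n E^(2n-1). In the induction the shifted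
  weight j + 1 splits into j and 1, and the part with weight 1 is the unweighted sum already
  known.\<close>

lemma sum_choose_index_recurrence:
  "(\<Sum>j\<le>n. real (n choose j) * (real j * G (int j + m))) = real n * G (2 * int n + m - 1)"
proof (induction n arbitrary: m)
  case (Suc n)
  have "(\<Sum>j\<le>Suc n. real (Suc n choose j) * (real j * G (int j + m)))
      = (\<Sum>j\<le>n. real (n choose j) * (real j * G (int j + m)))
        + (\<Sum>j\<le>n. real (n choose j) * (real j * G (int j + (m + 1))))
        + (\<Sum>j\<le>n. real (n choose j) * G (int j + (m + 1)))"
    by (subst sum_choose_Suc) (simp add: distrib_left sum.distrib algebra_simps)
  also have "\<dots> = real n * G (2 * int n + m - 1) + real n * G (2 * int n + m)
                  + G (2 * int n + m + 1)"
    by (simp only: Suc.IH sum_choose_recurrence) (simp add: algebra_simps)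
  also have "\<dots> = real (Suc n) * G (2 * int (Suc n) + m - 1)"
    using rec[of "2 * int n + m - 1"] by (simp add: algebra_simps)
  finally show ?case .
qed simp

lemma sum_choose_floor_half_recurrence:
  "(\<Sum>j = 1..n. real (n choose j) * real_of_int \<lfloor>real j / 2\<rfloor> * G (int j + m))
     = real n / 2 * G (2 * int n + m - 1)
       - 1 / 4 * (G (2 * int n + m) - (- 1) ^ n * G (m - int n))"
proof -
  have "(\<Sum>j = 1..n. real (n choose j) * real_of_int \<lfloor>real j / 2\<rfloor> * G (int j + m))
      = (\<Sum>j\<le>n. real (n choose j) * real_of_int \<lfloor>real j / 2\<rfloor> * G (int j + m))"
    \<comment> \<open>The added term j = 0 vanishes, since its floor is 0.\<close>
    by (rule sum.mono_neutral_left) (auto simp: not_le)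
  also have "\<dots> = (\<Sum>j\<le>n. real (n choose j) * (real j * G (int j + m))) / 2
      - (\<Sum>j\<le>n. real (n choose j) * G (int j + m)) / 4
      + (\<Sum>j\<le>n. real (n choose j) * ((- 1) ^ j * G (int j + m))) / 4"
    unfolding real_floor_half sum_divide_distrib sum_subtractf[symmetric] sum.distrib[symmetric]
    by (rule sum.cong) (simp_all add: field_simps)
  finally show ?thesis
    unfolding sum_choose_recurrence sum_choose_alternating_recurrence
      sum_choose_index_recurrence by (simp add: field_simps)
qed

end

lemma fib_int_of_nat: "fib_int (int n) = int (fib n)"
  by (simp add: fib_int_def)

text \<open>Pulling one sign out removes the truncated exponent n - 1, so the formula also covers n
  = 0, where \<open>fib 0\<close> is 0.\<close>

lemma fib_int_minus_of_nat: "fib_int (- int n) = - ((- 1) ^ n * int (fib n))"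
  by (cases n) (auto simp: fib_int_def nat_add_distrib)

lemma lucas_int_of_nat: "lucas_int (int n) = int (lucas n)"
  by (simp add: lucas_int_def)

lemma lucas_int_minus_of_nat: "lucas_int (- int n) = (- 1) ^ n * int (lucas n)"
  by (cases n) (auto simp: lucas_int_def nat_add_distrib)

text \<open>Three consecutive indices lie all on the nonnegative side or all on the nonpositive
  side, except when they are -1, 0, 1. Within one side a single closed form applies to all
  three.\<close>

lemma int_recurrence_cases:
  fixes k :: int
  obtains n where "k = int n" "k + 1 = int (Suc n)" "k + 2 = int (Suc (Suc n))"
  | "k = - 1"
  | n where "k = - int (Suc (Suc n))" "k + 1 = - int (Suc n)" "k + 2 = - int n"
proof -
  consider "k \<ge> 0" | "k = - 1" | "k \<le> - 2" by linarith
  then show thesis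
  proof cases
    case 1
    then show ?thesis using that(1)[of "nat k"] by simp
  next
    case 2
    then show ?thesis using that(2) by simp
  next
    case 3
    then show ?thesis using that(3)[of "nat (- k - 2)"] by simp
  qed
qed

lemma fib_int_rec: "fib_int (k + 2) = fib_int (k + 1) + fib_int k"
proof (cases k rule: int_recurrence_cases)
  case (1 n)
  then show ?thesis by (simp only: fib_int_of_nat) simp
next
  case 2
  then show ?thesis by (simp add: fib_int_def)
next
  case (3 n)
  then show ?thesis by (simp only: fib_int_minus_of_nat) (simp add: algebra_simps)
qed

lemma lucas_int_rec: "lucas_int (k + 2) = lucas_int (k + 1) + lucas_int k"
proof (cases k rule: int_recurrence_cases)
  case (1 n)
  then show ?thesis by (simp only: lucas_int_of_nat) simp
next
  case 2
  then show ?thesis by (simp add: lucas_int_def)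
next
  case (3 n)
  then show ?thesis by (simp only: lucas_int_minus_of_nat) (simp add: algebra_simps)
qed

lemma fib_int_minus: "real_of_int (fib_int (- k)) = - ((- 1) powi k * real_of_int (fib_int k))"
proof (cases k rule: int_cases2)
  case (nonneg n)
  then show ?thesis by (simp add: fib_int_of_nat fib_int_minus_of_nat)
next
  case (nonpos n)
  then show ?thesis
    \<comment> \<open>The sign from the reflection and the sign from the negative index are brought
      together and cancel.\<close>
    by (simp add: fib_int_of_nat fib_int_minus_of_nat power_int_minus flip: power_mult_distrib mult.assoc)
qed

lemma lucas_int_minus: "real_of_int (lucas_int (- k)) = (- 1) powi k * real_of_int (lucas_int k)"
proof (cases k rule: int_cases2)
  case (nonneg n)
  then show ?thesis by (simp add: lucas_int_of_nat lucas_int_minus_of_nat)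
next
  case (nonpos n)
  then show ?thesis
    by (simp add: lucas_int_of_nat lucas_int_minus_of_nat power_int_minus flip: power_mult_distrib mult.assoc)
qed

text \<open>Only parity matters, and 2n - m has the parity of m.\<close>

lemma minus_one_power_mult_powi_diff:
  "(- 1) ^ n * (- 1) powi (int n - m) = ((- 1) powi m :: 'a::field)"
  by (auto simp: minus_one_power_iff power_int_minus_left)

theorem theorem15:
  fixes m :: int and n :: nat
  assumes "n \<ge> 1"
  shows "(\<Sum>j = 1..n. real (n choose j) * real_of_int \<lfloor>real j / 2\<rfloor> * real_of_int (fib_int (int j + m)))
           = real n / 2 * real_of_int (fib_int (2 * int n + m - 1))
             - 1 / 4 * (real_of_int (fib_int (2 * int n + m))
                        + (- 1) powi m * real_of_int (fib_int (int n - m)))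
       \<and> (\<Sum>j = 1..n. real (n choose j) * real_of_int \<lfloor>real j / 2\<rfloor> * real_of_int (lucas_int (int j + m)))
           = real n / 2 * real_of_int (lucas_int (2 * int n + m - 1))
             - 1 / 4 * (real_of_int (lucas_int (2 * int n + m))
                        - (- 1) powi m * real_of_int (lucas_int (int n - m)))"
proof -
  \<comment> \<open>Reflection at n - m: the extra minus sign for Fibonacci numbers, absent for
    Lucas numbers, is what makes the last terms of the two identities differ in sign.\<close>
  have "(- 1) ^ n * real_of_int (fib_int (m - int n))
      = - ((- 1) powi m * real_of_int (fib_int (int n - m)))"
    using fib_int_minus[of "int n - m"]
    by (simp flip: minus_one_power_mult_powi_diff[of n m])
  moreover have "(- 1) ^ n * real_of_int (lucas_int (m - int n))
      = (- 1) powi m * real_of_int (lucas_int (int n - m))"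
    using lucas_int_minus[of "int n - m"]
    by (simp flip: minus_one_power_mult_powi_diff[of n m])
  moreover note sum_choose_floor_half_recurrence[of "\<lambda>k. real_of_int (fib_int k)" n m]
    sum_choose_floor_half_recurrence[of "\<lambda>k. real_of_int (lucas_int k)" n m]
  ultimately show ?thesis
    by (simp add: fib_int_rec lucas_int_rec)
qed

end
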